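(* Let $k\geq 2$ be an integer and let $G$ be a simple graph of order $n\geq 11k$ with minimum degree $\delta(G)\geq k$. If $e(G)> \binom{n-k}{2}+k(k+1)$, then $G$ is Hamilton-connected unless $G$ is isomorphic to a subgraph of $S_{n}^{k}$ or of $T_{n}^{k}$.
   Context: All graphs are finite and simple; $e(G)$ is the number of edges of $G$. A graph is Hamilton-connected if every two distinct vertices are joined by a Hamilton path. $G+H$ denotes disjoint union, $G\vee H$ the join, $tK_1$ the edgeless graph on $t$ vertices. Define $S_{n}^{k}=K_{k}\vee (K_{n-(2k-1)}+(k-1)K_{1})$ and $T_{n}^{k}=K_{2}\vee (K_{n-(k+1)}+K_{k-1})$. *)

theory Defs
  imports "Graph_Theory.Graph_Theory"
begin

text \<open>
  A finite simple graph is a \<open>pair_graph\<close>: finite vertex set, loopless, and with a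
  symmetric arc set, so that each edge \<open>{u, v}\<close> is represented by the two arcs \<open>(u, v)\<close>
  and \<open>(v, u)\<close>. Hence the degree of a vertex is its out-degree, and edges are counted as
  unordered pairs.
\<close>

definition edges :: "'a pair_pre_digraph \<Rightarrow> 'a set set" where
  "edges G = {{u, v} | u v. (u, v) \<in> parcs G}"

definition num_edges :: "'a pair_pre_digraph \<Rightarrow> nat" where
  "num_edges G = card (edges G)"

text \<open>Meaningful only for finite graphs with at least one vertex.\<close>

definition min_degree :: "'a pair_pre_digraph \<Rightarrow> nat" where
  "min_degree G = Min (out_degree (with_proj G) ` pverts G)"

definition hamilton_path :: "'a pair_pre_digraph \<Rightarrow> 'a \<Rightarrow> 'a list \<Rightarrow> 'a \<Rightarrow> bool" where
  "hamilton_path G u p v \<longleftrightarrow>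
     vpath p (with_proj G) \<and> set p = pverts G \<and> hd p = u \<and> last p = v"

definition hamilton_connected :: "'a pair_pre_digraph \<Rightarrow> bool" where
  "hamilton_connected G \<longleftrightarrow>
     (\<forall>u \<in> pverts G. \<forall>v \<in> pverts G. u \<noteq> v \<longrightarrow> (\<exists>p. hamilton_path G u p v))"

definition iso_to_subgraph :: "'a pair_pre_digraph \<Rightarrow> 'b pair_pre_digraph \<Rightarrow> bool" where
  "iso_to_subgraph G H \<longleftrightarrow>
     (\<exists>H'. pair_graph H' \<and> subgraph (with_proj H') (with_proj H) \<and>
           digraph_iso (with_proj G) (with_proj H'))"

definition complete_graph :: "nat \<Rightarrow> nat pair_pre_digraph" where
  "complete_graph m = \<lparr> pverts = {..<m}, parcs = {(u, v). u < m \<and> v < m \<and> u \<noteq> v} \<rparr>"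

definition edgeless_graph :: "nat \<Rightarrow> nat pair_pre_digraph" where
  "edgeless_graph t = \<lparr> pverts = {..<t}, parcs = {} \<rparr>"

definition disjoint_union ::
  "'a pair_pre_digraph \<Rightarrow> 'b pair_pre_digraph \<Rightarrow> ('a + 'b) pair_pre_digraph" where
  "disjoint_union G H =
     \<lparr> pverts = pverts G <+> pverts H,
       parcs = map_prod Inl Inl ` parcs G \<union> map_prod Inr Inr ` parcs H \<rparr>"

definition graph_join ::
  "'a pair_pre_digraph \<Rightarrow> 'b pair_pre_digraph \<Rightarrow> ('a + 'b) pair_pre_digraph" where
  "graph_join G H =
     \<lparr> pverts = pverts G <+> pverts H,
       parcs = parcs (disjoint_union G H)
         \<union> (Inl ` pverts G) \<times> (Inr ` pverts H) \<union> (Inr ` pverts H) \<times> (Inl ` pverts G) \<rparr>"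

text \<open>
  In the next two definitions the subtractions are on natural numbers; they agree with the
  integer ones when \<open>k \<ge> 1\<close> and \<open>n\<close> is at least \<open>2 * k - 1\<close>, respectively \<open>k + 1\<close>.
\<close>

definition S_graph :: "nat \<Rightarrow> nat \<Rightarrow> (nat + nat + nat) pair_pre_digraph" where
  "S_graph n k =
     graph_join (complete_graph k)
       (disjoint_union (complete_graph (n - (2 * k - 1))) (edgeless_graph (k - 1)))"

definition T_graph :: "nat \<Rightarrow> nat \<Rightarrow> (nat + nat + nat) pair_pre_digraph" where
  "T_graph n k =
     graph_join (complete_graph 2)
       (disjoint_union (complete_graph (n - (k + 1))) (complete_graph (k - 1)))"

lemma pair_graphI:
  assumes "finite (pverts G)" "parcs G \<subseteq> pverts G \<times> pverts G" "sym (parcs G)" "irrefl (parcs G)"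
  shows "pair_graph G"
proof
  show "finite (parcs G)"
    using assms(1,2) by (meson finite_SigmaI finite_subset)
  show "symmetric (with_proj G)"
    using assms(3) by (simp add: symmetric_def)
qed (use assms in \<open>auto simp: irrefl_def\<close>)

lemma pair_graphD:
  assumes "pair_graph G"
  shows "finite (pverts G)" "parcs G \<subseteq> pverts G \<times> pverts G" "sym (parcs G)" "irrefl (parcs G)"
proof -
  interpret pair_graph G by fact
  show "finite (pverts G)" by (rule pair_finite_verts)
  show "parcs G \<subseteq> pverts G \<times> pverts G" by (auto dest: in_arcsD1 in_arcsD2)
  show "sym (parcs G)" by (auto intro: symI arcs_symmetric)
  show "irrefl (parcs G)" by (auto simp: irrefl_def dest: no_loops')
qed

lemma pair_graph_complete: "pair_graph (complete_graph m)"
  by (rule pair_graphI) (auto simp: complete_graph_def sym_def irrefl_def)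

lemma pair_graph_edgeless: "pair_graph (edgeless_graph t)"
  by (rule pair_graphI) (auto simp: edgeless_graph_def sym_def irrefl_def)

lemma pair_graph_disjoint_union:
  assumes "pair_graph G" "pair_graph H"
  shows "pair_graph (disjoint_union G H)"
proof (rule pair_graphI)
  note G = pair_graphD[OF assms(1)] and H = pair_graphD[OF assms(2)]
  show "finite (pverts (disjoint_union G H))"
    using G(1) H(1) by (simp add: disjoint_union_def)
  show "parcs (disjoint_union G H) \<subseteq> pverts (disjoint_union G H) \<times> pverts (disjoint_union G H)"
    using G(2) H(2) by (auto simp: disjoint_union_def)
  show "sym (parcs (disjoint_union G H))"
    using symD[OF G(3)] symD[OF H(3)] by (intro symI) (auto simp: disjoint_union_def)
  show "irrefl (parcs (disjoint_union G H))"
    using G(4) H(4) by (auto simp: irrefl_def disjoint_union_def)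
qed

lemma pair_graph_join:
  assumes "pair_graph G" "pair_graph H"
  shows "pair_graph (graph_join G H)"
proof (rule pair_graphI)
  note G = pair_graphD[OF assms(1)] and H = pair_graphD[OF assms(2)]
  show "finite (pverts (graph_join G H))"
    using G(1) H(1) by (simp add: graph_join_def disjoint_union_def)
  show "parcs (graph_join G H) \<subseteq> pverts (graph_join G H) \<times> pverts (graph_join G H)"
    using G(2) H(2) by (auto simp: graph_join_def disjoint_union_def)
  show "sym (parcs (graph_join G H))"
    using symD[OF G(3)] symD[OF H(3)] by (intro symI) (auto simp: graph_join_def disjoint_union_def)
  show "irrefl (parcs (graph_join G H))"
    using G(4) H(4) by (auto simp: irrefl_def graph_join_def disjoint_union_def)
qed

lemma pair_graph_S: "pair_graph (S_graph n k)"
  and pair_graph_T: "pair_graph (T_graph n k)"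
  unfolding S_graph_def T_graph_def
  by (intro pair_graph_join pair_graph_disjoint_union pair_graph_complete pair_graph_edgeless)+

lemma card_pverts_S:
  assumes "k \<ge> 1" "n \<ge> 2 * k - 1"
  shows "card (pverts (S_graph n k)) = n"
  using assms
  by (simp add: S_graph_def graph_join_def disjoint_union_def complete_graph_def
      edgeless_graph_def card_Plus)

lemma card_pverts_T:
  assumes "k \<ge> 1" "n \<ge> k + 1"
  shows "card (pverts (T_graph n k)) = n"
  using assms
  by (simp add: T_graph_def graph_join_def disjoint_union_def complete_graph_def card_Plus)

end

theory Submission
  imports Defs
begin

text \<open>
  Fix distinct \<open>u\<close>, \<open>v\<close> without a Hamilton path between them and add edges as long as none
  appears. In the resulting graph, non-adjacent vertices have degree sum at most \<open>n\<close> (Ore's rotation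
  argument), so the vertices of degree at least \<open>(n + 1) / 2\<close> form a clique \<open>K\<close>. If \<open>q\<close> vertices
  lie outside \<open>K\<close>, counting edges first gives \<open>q < 4k\<close>, whence the outside vertices have degree at
  most \<open>q + 1\<close>; counting again gives \<open>q < k\<close>. With \<open>\<delta> \<ge> k\<close> this forces \<open>q = k - 1\<close> and outside
  degrees exactly \<open>k\<close>, and then all outside vertices have the same neighbourhood \<open>W\<close> in \<open>K\<close>, where
  \<open>2 \<le> |W| \<le> k\<close>. The extreme sizes of \<open>W\<close> give subgraphs of \<open>T\<close> and \<open>S\<close>. For \<open>2 < |W| < k\<close>
  shrink \<open>K - W\<close> to one vertex: the Ore closure of the small graph is complete, and the removed
  vertices can be inserted back into a Hamilton path.
\<close>

section \<open>Hamilton paths with prescribed ends\<close>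

text \<open>The combinatorial core works with plain relations, so that adding edges and cutting down
  to a vertex set are set operations; graph records return only in the last lemmas.\<close>

definition simple_on :: "'a set \<Rightarrow> 'a rel \<Rightarrow> bool" where
  "simple_on V E \<longleftrightarrow> E \<subseteq> V \<times> V \<and> sym E \<and> irrefl E"

lemma simple_on_restrict:
  assumes "simple_on V E"
  shows "simple_on U (E \<inter> U \<times> U)"
proof -
  have "sym (E \<inter> U \<times> U)"
    using assms by (intro symI) (auto simp: simple_on_def dest: symD)
  moreover have "irrefl (E \<inter> U \<times> U)"
    using assms by (auto simp: simple_on_def irrefl_def)
  ultimately show ?thesis by (simp add: simple_on_def)
qed

inductive ham_path :: "'a set \<Rightarrow> 'a rel \<Rightarrow> 'a \<Rightarrow> 'a \<Rightarrow> bool"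
  for V E where
    ham_pathI: "\<lbrakk>p \<noteq> []; distinct p; set p = V; hd p = u; last p = v;
      successively (\<lambda>a b. (a, b) \<in> E) p\<rbrakk> \<Longrightarrow> ham_path V E u v"

lemma ham_path_mono:
  assumes "ham_path V E u v" "E \<subseteq> E'"
  shows "ham_path V E' u v"
proof -
  obtain p where "p \<noteq> []" "distinct p" "set p = V" "hd p = u" "last p = v"
    "successively (\<lambda>a b. (a, b) \<in> E) p"
    using assms(1) unfolding ham_path.simps by blast
  then show ?thesis
    using assms(2) by (intro ham_pathI[of p]) (auto elim: successively_mono)
qed

lemma ham_path_restrict:
  assumes "ham_path V (E \<inter> V \<times> V) u v"
  shows "ham_path V E u v"
  using ham_path_mono[OF assms] by blast

section \<open>Rotations and Ore's closure\<close>

text \<open>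
  Reversing the stretch of \<open>p\<close> between positions \<open>Suc lo\<close> and \<open>hi\<close> removes the steps at \<open>lo\<close> and
  \<open>hi\<close>, which therefore need not be edges.
\<close>

lemma reverse_segment:
  assumes E: "sym E"
    and p: "p \<noteq> []" "distinct p" "lo < hi" "Suc hi < length p"
    and steps: "\<And>i. Suc i < length p \<Longrightarrow> i \<noteq> lo \<Longrightarrow> i \<noteq> hi \<Longrightarrow> (p ! i, p ! Suc i) \<in> E"
    and new: "(p ! lo, p ! hi) \<in> E" "(p ! Suc lo, p ! Suc hi) \<in> E"
  shows "ham_path (set p) E (hd p) (last p)"
proof -
  define P where "P = take (Suc lo) p"
  define Q where "Q = take (hi - lo) (drop (Suc lo) p)"
  define R where "R = drop (Suc hi) p"
  have "drop (hi - lo) (drop (Suc lo) p) = R"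
    using p(3) by (simp add: R_def)
  then have pPQR: "p = P @ Q @ R"
    unfolding P_def Q_def by (metis append_take_drop_id)
  have len: "length P = Suc lo" "length Q = hi - lo" "length R = length p - Suc hi"
    using p(3,4) by (auto simp: P_def Q_def R_def)
  then have ne: "P \<noteq> []" "Q \<noteq> []" "R \<noteq> []"
    using p(3,4) by auto
  have ends: "last P = p ! lo" "hd Q = p ! Suc lo" "last Q = p ! hi" "hd R = p ! Suc hi"
    using p(3,4) ne(2) len(2)
    by (simp_all add: P_def take_Suc_conv_app_nth Q_def R_def hd_drop_conv_nth last_conv_nth)
  let ?S = "successively (\<lambda>a b. (a, b) \<in> E)"
  have "?S P" unfolding successively_conv_nth
  proof (intro allI impI)
    fix i assume "Suc i < length P"
    then show "(P ! i, P ! Suc i) \<in> E"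
      using steps[of i] p(3,4) len by (simp add: P_def)
  qed
  moreover have SQ: "?S Q" unfolding successively_conv_nth
  proof (intro allI impI)
    fix i assume "Suc i < length Q"
    then show "(Q ! i, Q ! Suc i) \<in> E"
      using steps[of "Suc lo + i"] p(3,4) len by (simp add: Q_def)
  qed
  moreover have "?S R" unfolding successively_conv_nth
  proof (intro allI impI)
    fix i assume "Suc i < length R"
    then show "(R ! i, R ! Suc i) \<in> E"
      using steps[of "Suc hi + i"] p(3,4) len by (simp add: R_def)
  qed
  moreover have "?S (rev Q)"
    using SQ E by (auto elim: successively_mono dest: symD)
  ultimately have "?S (P @ rev Q @ R)"
    using ne new ends by (auto simp: successively_append_iff hd_append hd_rev last_rev simp del: successively_rev)
  then show ?thesis
    using p(2) ne by (intro ham_pathI[of "P @ rev Q @ R"]) (auto simp: pPQR)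
qed

lemma card_positions:
  assumes "distinct p" "X \<subseteq> set p"
  shows "card {i. i < length p \<and> p ! i \<in> X} = card X"
proof -
  have "bij_betw (\<lambda>i. p ! i) {i. i < length p \<and> p ! i \<in> X} X"
    using assms by (auto simp: bij_betw_def inj_on_def nth_eq_iff_index_eq image_iff)
      (metis in_set_conv_nth subsetD)
  then show ?thesis by (rule bij_betw_same_card)
qed

text \<open>Write n for \<open>length p\<close>, x for \<open>p ! i\<close>, y for
  \<open>p ! Suc i\<close>. If some j has x adjacent to \<open>p ! j\<close> and y adjacent to
  \<open>p ! Suc j\<close>, then \<open>reverse_segment\<close> repairs the missing step at i. Each
  of the two conditions holds for at least degree minus one positions, so together for n - 1 of
  them, while only n - 2 positions are available.\<close>

lemma ham_path_by_rotation:
  assumes E: "simple_on (set p) E" and p: "distinct p" "Suc i < length p"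
    and steps: "\<And>j. Suc j < length p \<Longrightarrow> j \<noteq> i \<Longrightarrow> (p ! j, p ! Suc j) \<in> E"
    and deg: "card (E `` {p ! i}) + card (E `` {p ! Suc i}) \<ge> length p + 1"
  shows "ham_path (set p) E (hd p) (last p)"
proof -
  note E' = E[unfolded simple_on_def]
  define n where "n = length p"
  define x y where "x = p ! i" and "y = p ! Suc i"
  define A where "A = {j. j < n \<and> p ! j \<in> E `` {x}}"
  define B where "B = {j. j < n \<and> p ! j \<in> E `` {y}}"
  define I where "I = {j. Suc j < n \<and> (x, p ! j) \<in> E}"
  define J where "J = {j. Suc j < n \<and> (y, p ! Suc j) \<in> E}"
  have fin: "finite I" "finite J"
    by (auto simp: I_def J_def intro: finite_subset[of _ "{..<n}"])
  have cA: "card A = card (E `` {x})" and cB: "card B = card (E `` {y})"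
    unfolding A_def B_def n_def using E' p(1) by (blast intro: card_positions)+
  \<comment> \<open>The last position has no successor; this costs at most one neighbour of x. The
    first position, having no predecessor, costs y one likewise.\<close>
  have "A \<subseteq> insert (n - 1) I"
    by (auto simp: A_def I_def)
  then have "card A \<le> card (insert (n - 1) I)"
    using fin by (intro card_mono) auto
  also have "\<dots> \<le> Suc (card I)"
    using fin by (simp add: card_insert_if)
  finally have cI: "card A \<le> Suc (card I)" .
  have "B \<subseteq> insert 0 (Suc ` J)"
  proof
    fix j assume "j \<in> B"
    then show "j \<in> insert 0 (Suc ` J)"
      by (cases j) (auto simp: B_def J_def)
  qed
  then have "card B \<le> card (insert 0 (Suc ` J))"
    using fin by (intro card_mono) auto
  also have "\<dots> \<le> Suc (card J)"
    using fin by (simp add: card_insert_if card_image)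
  finally have cJ: "card B \<le> Suc (card J)" .
  have irr: "(a, a) \<notin> E" for a
    using E' by (auto simp: irrefl_def)
  \<comment> \<open>Position i itself drops out by irreflexivity: it would need a loop at x or at y.
    Without this the pigeonhole would be one short.\<close>
  have sub: "I \<union> J \<subseteq> {..<n - 1} - {i}"
    using irr by (auto simp: I_def J_def x_def y_def)
  have "card (I \<union> J) \<le> n - 2"
    using card_mono[OF _ sub] p(2) by (simp add: n_def)
  moreover have "card I + card J = card (I \<union> J) + card (I \<inter> J)"
    using fin by (rule card_Un_Int)
  ultimately have "card (I \<inter> J) > 0"
    using cA cB cI cJ deg p(2) by (simp add: n_def x_def y_def)
  then obtain j where j: "j \<in> I" "j \<in> J"
    by (metis IntE card_gt_0_iff ex_in_conv)
  then have "j \<noteq> i" using sub by auto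
  have jl: "Suc j < length p" "(p ! i, p ! j) \<in> E" "(p ! Suc i, p ! Suc j) \<in> E"
    using j by (auto simp: I_def J_def n_def x_def y_def)
  have sE: "sym E" using E' by auto
  show ?thesis
  proof (cases "i < j")
    case True
    then show ?thesis
      using p jl steps by (intro reverse_segment[OF sE, of p i j]) auto
  next
    case False
    then show ?thesis
      using p jl steps \<open>j \<noteq> i\<close> symD[OF sE jl(2)] symD[OF sE jl(3)]
      by (intro reverse_segment[OF sE, of p j i]) auto
  qed
qed

text \<open>A path without repeated vertices uses the new edge at most once, so at most one of its
  steps is missing in \<open>E\<close>, and a rotation repairs that step.\<close>

lemma ham_path_add_edge:
  assumes E: "simple_on V E" and xy: "(x, y) \<notin> E" "x \<noteq> y"
    and hp: "ham_path V (E \<union> {(x, y), (y, x)}) u v"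
    and deg: "card (E `` {x}) + card (E `` {y}) \<ge> card V + 1"
  shows "ham_path V E u v"
proof -
  obtain p where p: "p \<noteq> []" "distinct p" "set p = V" "hd p = u" "last p = v"
    and s: "successively (\<lambda>a b. (a, b) \<in> E \<union> {(x, y), (y, x)}) p"
    using hp unfolding ham_path.simps by blast
  have n: "length p = card V" using p distinct_card by metis
  show ?thesis
  proof (cases "successively (\<lambda>a b. (a, b) \<in> E) p")
    case True
    then show ?thesis using p by (intro ham_pathI[of p])
  next
    case False
    then obtain i where i: "Suc i < length p" "(p ! i, p ! Suc i) \<notin> E"
      by (auto simp: successively_conv_nth)
    then have ixy: "(p ! i = x \<and> p ! Suc i = y) \<or> (p ! i = y \<and> p ! Suc i = x)"
      using successively_nth[OF s, of i] by auto
    have "(p ! j, p ! Suc j) \<in> E" if j: "Suc j < length p" "j \<noteq> i" for j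
    proof (rule ccontr)
      assume "(p ! j, p ! Suc j) \<notin> E"
      then have "(p ! j = x \<and> p ! Suc j = y) \<or> (p ! j = y \<and> p ! Suc j = x)"
        using successively_nth[OF s, of j] j by auto
      \<comment> \<open>Vertices of p determine their positions, so a second step over x and y would
        occupy the same two positions; taking them in the opposite order is absurd.\<close>
      then have "j = i \<or> (j = Suc i \<and> Suc j = i)"
        using ixy i j p(2) nth_eq_iff_index_eq[OF p(2)] by (metis Suc_lessD)
      then show False using j by auto
    qed
    then have "ham_path (set p) E (hd p) (last p)"
      using E i p n deg ixy by (intro ham_path_by_rotation[of p E i]) (auto simp: add.commute)
    then show ?thesis using p by simp
  qed
qed

lemma ham_path_complete:
  fixes V :: "'a set"
  assumes "finite V" "u \<in> V" "v \<in> V" "u \<noteq> v"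
    and complete: "\<And>x y. x \<in> V \<Longrightarrow> y \<in> V \<Longrightarrow> x \<noteq> y \<Longrightarrow> (x, y) \<in> E"
  shows "ham_path V E u v"
proof -
  obtain q where q: "set q = V - {u, v}" "distinct q"
    using finite_distinct_list[of "V - {u, v}"] assms(1) by blast
  let ?p = "u # q @ [v]"
  have d: "distinct ?p" and s: "set ?p = V" using q assms by auto
  have "distinct xs \<Longrightarrow> sorted_wrt (\<noteq>) xs" for xs :: "'a list"
    by (induction xs) auto
  then have "sorted_wrt (\<noteq>) ?p" using d by blast
  then have "sorted_wrt (\<lambda>a b. (a, b) \<in> E) ?p"
    by (rule sorted_wrt_mono_rel[rotated]) (use s complete in blast)
  then show ?thesis
    using d s by (intro ham_pathI[of ?p] successively_if_sorted_wrt) auto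
qed

text \<open>Ore's closure as a proof rule. Among the supergraphs without the path take a maximal
  one. Joining a non-adjacent pair of large degree sum would create a path, which
  \<open>ham_path_add_edge\<close> then carries back, so no such pair exists. The graph is also not
  complete, as a complete graph has the path. The rule serves twice: for the dense graph itself and
  for the small graph in \<open>ham_path_join_clique_regular\<close>.\<close>

lemma ham_path_by_closure:
  assumes fin: "finite V" and E: "simple_on V E" and uv: "u \<in> V" "v \<in> V" "u \<noteq> v"
    and closed: "\<And>E'. \<lbrakk>E \<subseteq> E'; simple_on V E';
        \<And>x y. \<lbrakk>x \<in> V; y \<in> V; x \<noteq> y; card (E' `` {x}) + card (E' `` {y}) \<ge> card V + 1\<rbrakk>
          \<Longrightarrow> (x, y) \<in> E';
        \<not> (\<forall>x\<in>V. \<forall>y\<in>V. x \<noteq> y \<longrightarrow> (x, y) \<in> E')\<rbrakk> \<Longrightarrow> ham_path V E' u v"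
  shows "ham_path V E u v"
proof (rule ccontr)
  assume no: "\<not> ham_path V E u v"
  define \<E> where "\<E> = {E'. E \<subseteq> E' \<and> simple_on V E' \<and> \<not> ham_path V E' u v}"
  have "finite \<E>"
    using fin by (intro finite_subset[of \<E> "Pow (V \<times> V)"]) (auto simp: \<E>_def simple_on_def)
  moreover have "E \<in> \<E>" using no E by (simp add: \<E>_def)
  ultimately obtain M where M: "M \<in> \<E>" and "\<forall>E'\<in>\<E>. M \<subseteq> E' \<longrightarrow> M = E'"
    by (blast dest: finite_has_maximal2)
  then have max: "\<And>E'. E' \<in> \<E> \<Longrightarrow> M \<subseteq> E' \<Longrightarrow> M = E'" by blast
  have "ham_path V M u v"
  proof (rule closed)
    fix x y assume xy: "x \<in> V" "y \<in> V" "x \<noteq> y"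
      and deg: "card (M `` {x}) + card (M `` {y}) \<ge> card V + 1"
    show "(x, y) \<in> M"
    proof (rule ccontr)
      assume non: "(x, y) \<notin> M"
      let ?M = "M \<union> {(x, y), (y, x)}"
      have "simple_on V ?M"
        using M xy by (auto simp: \<E>_def simple_on_def sym_def irrefl_def)
      moreover have "?M \<notin> \<E>" using max[of ?M] non by blast
      ultimately have "ham_path V ?M u v" using M by (auto simp: \<E>_def)
      then have "ham_path V M u v"
        using M non xy deg by (intro ham_path_add_edge[of V M x y]) (auto simp: \<E>_def)
      then show False using M by (simp add: \<E>_def)
    qed
  next
    show "\<not> (\<forall>x\<in>V. \<forall>y\<in>V. x \<noteq> y \<longrightarrow> (x, y) \<in> M)"
      using M ham_path_complete[OF fin uv, of M] unfolding \<E>_def by blast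
  qed (use M in \<open>auto simp: \<E>_def\<close>)
  then show False using M by (simp add: \<E>_def)
qed

section \<open>Extending a Hamilton path by one vertex\<close>

text \<open>Place z' directly before z: the predecessor of z, which exists because z is not the
  first vertex, is adjacent to z' too.\<close>

lemma ham_path_insert_twin:
  assumes hp: "ham_path U E a b" and z: "z \<in> U" "z \<noteq> a"
    and z': "z' \<notin> U" "(z', z) \<in> E" "\<And>x. x \<in> U \<Longrightarrow> (x, z) \<in> E \<Longrightarrow> (x, z') \<in> E"
  shows "ham_path (insert z' U) E a b"
proof -
  obtain p where p: "p \<noteq> []" "distinct p" "set p = U" "hd p = a" "last p = b"
    and s: "successively (\<lambda>a b. (a, b) \<in> E) p"
    using hp unfolding ham_path.simps by blast
  obtain A B where AB: "p = A @ z # B" using p z by (metis split_list)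
  then have "A \<noteq> []" using p z by auto
  then have "last A \<in> U" "(last A, z) \<in> E"
    using AB p s by (auto simp: successively_append_iff)
  then have "(last A, z') \<in> E" using z' by auto
  then show ?thesis
    using AB p s \<open>A \<noteq> []\<close> z' z
    by (intro ham_pathI[of "A @ z' # z # B"]) (auto simp: successively_append_iff successively_Cons)
qed

lemma ham_path_snoc:
  assumes "ham_path U E a b" "v \<notin> U" "(b, v) \<in> E"
  shows "ham_path (insert v U) E a v"
proof -
  obtain p where p: "p \<noteq> []" "distinct p" "set p = U" "hd p = a" "last p = b"
    and s: "successively (\<lambda>a b. (a, b) \<in> E) p"
    using assms(1) unfolding ham_path.simps by blast
  then show ?thesis
    using assms by (intro ham_pathI[of "p @ [v]"]) (auto simp: successively_append_iff)
qed

lemma ham_path_sym: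
  assumes "sym E" "ham_path U E a b"
  shows "ham_path U E b a"
proof -
  obtain p where p: "p \<noteq> []" "distinct p" "set p = U" "hd p = a" "last p = b"
    and s: "successively (\<lambda>a b. (a, b) \<in> E) p"
    using assms(2) unfolding ham_path.simps by blast
  then show ?thesis
    using assms(1) by (intro ham_pathI[of "rev p"])
      (auto simp: hd_rev last_rev elim: successively_mono dest: symD)
qed

section \<open>The intermediate sizes of the common neighbourhood\<close>

text \<open>A single vertex z can stand for the clique Z. The graph on W, F and z has |W| + k
  vertices, and its Ore closure is complete, which uses both |W| < k and |W| >= 3. The other
  vertices of Z behave like z and are inserted before it. Ends lying in Z are appended last, through
  a vertex of W.\<close>

lemma ham_path_join_clique_regular:
  fixes W Z F :: "'a set"
  assumes fin: "finite W" "finite Z" "finite F"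
    and disj: "W \<inter> Z = {}" "W \<inter> F = {}" "Z \<inter> F = {}"
    and E: "simple_on (W \<union> Z \<union> F) E"
    and W: "\<And>w x. w \<in> W \<Longrightarrow> x \<in> W \<union> Z \<union> F \<Longrightarrow> x \<noteq> w \<Longrightarrow> (w, x) \<in> E"
    and Z: "\<And>x y. x \<in> Z \<Longrightarrow> y \<in> Z \<Longrightarrow> x \<noteq> y \<Longrightarrow> (x, y) \<in> E"
    and ZF: "\<And>x y. x \<in> Z \<Longrightarrow> y \<in> F \<Longrightarrow> (x, y) \<notin> E"
    and F: "\<And>x. x \<in> F \<Longrightarrow> card (E `` {x}) = k"
    and cards: "card F = k - 1" "3 \<le> card W" "card W < k" "3 \<le> card Z"
    and uv: "u \<in> W \<union> Z \<union> F" "v \<in> W \<union> Z \<union> F" "u \<noteq> v"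
  shows "ham_path (W \<union> Z \<union> F) E u v"
proof -
  note E' = E[unfolded simple_on_def]
  have sE: "sym E" using E' by blast
  have core: "ham_path (insert z (W \<union> F)) E a b"
    if z: "z \<in> Z" and ab: "a \<in> W \<union> F" "b \<in> W \<union> F" "a \<noteq> b" for z a b
  proof (rule ham_path_restrict, rule ham_path_by_closure)
    let ?U = "insert z (W \<union> F)"
    show "finite ?U" using fin by simp
    show "simple_on ?U (E \<inter> ?U \<times> ?U)"
      using E by (rule simple_on_restrict)
    show "a \<in> ?U" "b \<in> ?U" "a \<noteq> b" using ab by auto
    fix M assume sub: "E \<inter> ?U \<times> ?U \<subseteq> M" and M: "simple_on ?U M"
      and closed: "\<And>x y. x \<in> ?U \<Longrightarrow> y \<in> ?U \<Longrightarrow> x \<noteq> y \<Longrightarrow>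
        card ?U + 1 \<le> card (M `` {x}) + card (M `` {y}) \<Longrightarrow> (x, y) \<in> M"
      and incomplete: "\<not> (\<forall>x\<in>?U. \<forall>y\<in>?U. x \<noteq> y \<longrightarrow> (x, y) \<in> M)"
    have M': "M \<subseteq> ?U \<times> ?U" "sym M" using M by (auto simp: simple_on_def)
    have finM: "finite (M `` {x})" for x
    proof (rule finite_subset)
      show "M `` {x} \<subseteq> ?U" using M'(1) by blast
    qed (use fin in simp)
    have "z \<notin> W \<union> F" using z disj by blast
    then have cU: "card ?U = card W + k"
      using fin disj cards by (simp add: card_Un_disjoint)
    \<comment> \<open>No neighbour of a vertex of F lies in Z, so cutting Z down to z keeps the full
      degree k.\<close>
    have cF: "k \<le> card (M `` {x})" if "x \<in> F" for x
    proof -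
      have "E `` {x} \<subseteq> M `` {x}"
      proof
        fix y assume "y \<in> E `` {x}"
        then have y: "(x, y) \<in> E" by simp
        then have "y \<notin> Z" using ZF[of y x] that symD[OF sE] by blast
        then have "(x, y) \<in> E \<inter> ?U \<times> ?U" using y E' that by auto
        then show "y \<in> M `` {x}" using sub by blast
      qed
      then show ?thesis using F[OF that] finM card_mono by metis
    qed
    \<comment> \<open>2k >= (|W| + k) + 1 because |W| < k.\<close>
    have MF: "(x, y) \<in> M" if "x \<in> F" "y \<in> F" "x \<noteq> y" for x y
      using that cF[of x] cF[of y] cU cards by (intro closed) auto
    have MW: "(w, x) \<in> M" if "w \<in> W" "x \<in> ?U" "x \<noteq> w" for w x
      using W[of w x] that z sub by auto
    then have MW': "(x, w) \<in> M" if "w \<in> W" "x \<in> ?U" "x \<noteq> w" for w x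
      using that symD[OF M'(2)] by blast
    \<comment> \<open>Now that F is a clique in \<open>M\<close>, x has at least |W| + k - 2
      neighbours and z at least |W|. The sum reaches |W| + k + 1 exactly when |W| >= 3.\<close>
    have Mz: "(x, z) \<in> M" if x: "x \<in> F" for x
    proof (rule closed)
      have "W \<union> (F - {x}) \<subseteq> M `` {x}"
        using MW' MF x disj by blast
      then have "card (W \<union> (F - {x})) \<le> card (M `` {x})"
        using finM by (intro card_mono)
      moreover have "card (W \<union> (F - {x})) = card W + card (F - {x})"
        using fin disj by (intro card_Un_disjoint) auto
      ultimately have 1: "card W + (k - 2) \<le> card (M `` {x})"
        using x cards fin by simp
      have "W \<subseteq> M `` {z}"
        using MW' z disj by blast
      then have 2: "card W \<le> card (M `` {z})"
        using finM by (intro card_mono)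
      show "card ?U + 1 \<le> card (M `` {x}) + card (M `` {z})"
        using 1 2 cU cards by linarith
    qed (use x z disj in auto)
    have "(x, y) \<in> M" if "x \<in> ?U" "y \<in> ?U" "x \<noteq> y" for x y
      using that MF MW MW' Mz symD[OF M'(2) Mz] by blast
    with incomplete show "ham_path ?U M a b" by blast
  qed
  have blow: "ham_path (insert z (W \<union> F) \<union> Z') E a b"
    if z: "z \<in> Z" and ab: "a \<in> W \<union> F" "b \<in> W \<union> F" "a \<noteq> b"
      and Z': "finite Z'" "Z' \<subseteq> Z - {z}" for z a b Z'
    using Z'
  proof (induction rule: finite_induct)
    case empty
    then show ?case using core[OF z ab] by simp
  next
    case (insert z' Z')
    have z': "z' \<in> Z" "z' \<noteq> z" using insert by auto
    have "ham_path (insert z' (insert z (W \<union> F) \<union> Z')) E a b"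
    proof (rule ham_path_insert_twin[where z = z])
      show "ham_path (insert z (W \<union> F) \<union> Z') E a b" using insert by simp
      show "z' \<notin> insert z (W \<union> F) \<union> Z'" using insert disj by auto
      show "(z', z) \<in> E" using Z z z' by simp
      show "z \<noteq> a" using ab z disj by auto
      fix x assume x: "x \<in> insert z (W \<union> F) \<union> Z'" "(x, z) \<in> E"
      then have "x \<noteq> z" using E' by (auto simp: irrefl_def)
      moreover have "x \<notin> F" using ZF[OF z] x sE by (auto dest: symD)
      moreover have "x \<noteq> z'" using x insert disj z' by auto
      ultimately show "(x, z') \<in> E"
        using x insert.prems Z W z' by auto
    qed simp
    then show ?case by simp
  qed
  have paths: "ham_path (W \<union> F \<union> Y) E a b"
    if "a \<in> W \<union> F" "b \<in> W \<union> F" "a \<noteq> b" "Y \<subseteq> Z" "Y \<noteq> {}" for a b Y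
  proof -
    obtain z where z: "z \<in> Y" using \<open>Y \<noteq> {}\<close> by blast
    have "ham_path (insert z (W \<union> F) \<union> (Y - {z})) E a b"
      using that z fin by (intro blow) (auto intro: finite_subset)
    moreover have "insert z (W \<union> F) \<union> (Y - {z}) = W \<union> F \<union> Y" using z by auto
    ultimately show ?thesis by simp
  qed
  have avoid: "\<exists>w \<in> W. w \<noteq> x" for x
  proof (rule ccontr)
    assume "\<not> ?thesis"
    then have "W \<subseteq> {x}" by auto
    then show False using cards card_mono[of "{x}" W] by simp
  qed
  have ne: "Z - {x, y} \<noteq> {}" for x y
  proof
    assume "Z - {x, y} = {}"
    then have "card Z \<le> card {x, y}" by (intro card_mono) auto
    then show False using cards card_insert_le_m1[of 2 "{y}" x] by (simp add: card_insert_if split: if_splits)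
  qed
  \<comment> \<open>Run through everything but b, finish at some w in W, and step to b. The set
    \<open>Y\<close> is left free so that two ends in Z can be treated by setting one of them
    aside.\<close>
  have one: "ham_path (W \<union> F \<union> Y) E a b"
    if a: "a \<in> W \<union> F" and b: "b \<in> Y" and Y: "Y \<subseteq> Z" "Y - {b} \<noteq> {}" for a b Y
  proof -
    obtain w where w: "w \<in> W" "w \<noteq> a" using avoid by blast
    have "ham_path (W \<union> F \<union> (Y - {b})) E a w"
      using a w Y by (intro paths) auto
    then have "ham_path (insert b (W \<union> F \<union> (Y - {b}))) E a b"
      using w b Y disj W[of w b] by (intro ham_path_snoc[where b = w]) auto
    moreover have "insert b (W \<union> F \<union> (Y - {b})) = W \<union> F \<union> Y" using b by auto
    ultimately show ?thesis by simp
  qed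
  have VE: "W \<union> Z \<union> F = W \<union> F \<union> Z" by auto
  consider "u \<in> W \<union> F" "v \<in> W \<union> F" | "u \<in> W \<union> F" "v \<in> Z" | "u \<in> Z" "v \<in> W \<union> F" | "u \<in> Z" "v \<in> Z"
    using uv by auto
  then show ?thesis
  proof cases
    case 1
    then show ?thesis unfolding VE using uv ne by (intro paths) auto
  next
    case 2
    then show ?thesis unfolding VE using ne[of v v] by (intro one) auto
  next
    case 3
    then have "ham_path (W \<union> F \<union> Z) E v u" using ne[of u u] by (intro one) auto
    then show ?thesis unfolding VE using ham_path_sym[OF sE] by blast
  next
    case 4
    \<comment> \<open>Omit u, join v to w by \<open>one\<close>, then append u. Here
      \<open>one\<close> asks for a vertex of Z other than u and v, hence |Z| >= 3.\<close>
    obtain w where w: "w \<in> W" using avoid by blast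
    have "ham_path (W \<union> F \<union> (Z - {u})) E w v"
      using 4 w uv ne[of u v] by (intro one) auto
    then have "ham_path (W \<union> F \<union> (Z - {u})) E v w"
      using ham_path_sym[OF sE] by blast
    then have "ham_path (insert u (W \<union> F \<union> (Z - {u}))) E v u"
      using w 4 disj W[of w u] by (intro ham_path_snoc[where b = w]) auto
    moreover have "insert u (W \<union> F \<union> (Z - {u})) = W \<union> F \<union> Z" using 4 by auto
    ultimately show ?thesis unfolding VE using ham_path_sym[OF sE] by metis
  qed
qed

section \<open>Structure of dense graphs closed under Ore's condition\<close>

text \<open>Every edge contributes two pairs to \<open>E\<close>, so the density hypothesis and the
  counts are doubled edge counts. The first count is crude, but q < 4k is enough to bound the
  outside degrees by q + 1; that bound makes the second count sharp.\<close>

lemma closed_dense_structure: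
  fixes V :: "'a set" and n k :: nat
  defines "d \<equiv> \<lambda>E :: 'a rel. \<lambda>x. card (E `` {x})"
  assumes fin: "finite V" and n: "card V = n" "n \<ge> 11 * k" and k: "k \<ge> 2"
    and E: "simple_on V E"
    and mind: "\<And>x. x \<in> V \<Longrightarrow> k \<le> d E x"
    and dense: "card E > (n - k) * (n - k - 1) + 2 * k * (k + 1)"
    and closed: "\<And>x y. x \<in> V \<Longrightarrow> y \<in> V \<Longrightarrow> x \<noteq> y \<Longrightarrow> n + 1 \<le> d E x + d E y \<Longrightarrow> (x, y) \<in> E"
    and incomplete: "\<not> (\<forall>x \<in> V. \<forall>y \<in> V. x \<noteq> y \<longrightarrow> (x, y) \<in> E)"
  obtains W Z F where "V = W \<union> Z \<union> F" "W \<inter> Z = {}" "W \<inter> F = {}" "Z \<inter> F = {}"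
    "card F = k - 1" "2 \<le> card W" "card W \<le> k"
    "\<And>w x. w \<in> W \<Longrightarrow> x \<in> V \<Longrightarrow> x \<noteq> w \<Longrightarrow> (w, x) \<in> E"
    "\<And>x y. x \<in> Z \<Longrightarrow> y \<in> Z \<Longrightarrow> x \<noteq> y \<Longrightarrow> (x, y) \<in> E"
    "\<And>x y. x \<in> Z \<Longrightarrow> y \<in> F \<Longrightarrow> (x, y) \<notin> E"
    "\<And>x. x \<in> F \<Longrightarrow> d E x = k"
proof -
  have EV: "E \<subseteq> V \<times> V" and sE: "sym E" and irr: "(x, x) \<notin> E" for x
    using E by (auto simp: simple_on_def irrefl_def)
  have nbV: "E `` {x} \<subseteq> V - {x}" for x
    using EV irr by blast
  have finN: "finite (E `` {x})" for x
    by (rule finite_subset[OF nbV]) (use fin in simp)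
  define K where "K = {x \<in> V. n + 1 \<le> 2 * d E x}"
  define F where "F = V - K"
  define q where "q = card F"
  have KV: "K \<subseteq> V" and FV: "F \<subseteq> V" by (auto simp: K_def F_def)
  have finK: "finite K" and finF: "finite F"
    using fin KV FV by (auto intro: finite_subset)
  have VKF: "V = K \<union> F" "K \<inter> F = {}" using KV by (auto simp: F_def)
  have "card V = card K + card F"
    using VKF finK finF by (metis card_Un_disjoint)
  then have cK: "card K = n - q" and qn: "q \<le> n" using n by (auto simp: q_def)
  have clique: "(x, y) \<in> E" if "x \<in> K" "y \<in> K" "x \<noteq> y" for x y
    using that by (intro closed) (auto simp: K_def)
  have "E = (SIGMA x:V. E `` {x})" using EV by auto
  then have cE: "card E = (\<Sum>x\<in>V. d E x)"
    unfolding d_def using fin finN by (metis card_SigmaI)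
  \<comment> \<open>Crude count: degree at most n - 1 inside K and at most n/2 outside.\<close>
  have "(\<Sum>x\<in>K. d E x) \<le> (\<Sum>x\<in>K. n - 1)"
  proof (rule sum_mono)
    fix x assume "x \<in> K"
    then have "card (V - {x}) = n - 1" using KV n fin by auto
    then show "d E x \<le> n - 1"
      unfolding d_def using card_mono[OF _ nbV[of x]] fin by simp
  qed
  then have sK: "(\<Sum>x\<in>K. d E x) \<le> (n - q) * (n - 1)" using cK by simp
  have "(\<Sum>x\<in>F. 2 * d E x) \<le> (\<Sum>x\<in>F. n)"
    by (rule sum_mono) (auto simp: F_def K_def)
  then have sF: "2 * (\<Sum>x\<in>F. d E x) \<le> q * n" by (simp add: q_def sum_distrib_left)
  have "card E = (\<Sum>x\<in>K. d E x) + (\<Sum>x\<in>F. d E x)"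
    unfolding cE using VKF finK finF by (simp add: sum.union_disjoint)
  with sK sF have bound1: "2 * card E \<le> 2 * ((n - q) * (n - 1)) + q * n" by linarith
  have nk: "n \<ge> k" "n \<ge> 22" using n(2) k by linarith+
  define N k' where "N = int n" and "k' = int k"
  have e: "int (n - k) = N - k'" "int (n - k - 1) = N - k' - 1"
    using n(2) k by (auto simp: N_def k'_def)
  have "int (card E) > int ((n - k) * (n - k - 1) + 2 * k * (k + 1))"
    using dense by (simp only: of_nat_less_iff)
  then have b2: "int (card E) > (N - k') * (N - k' - 1) + 2 * k' * (k' + 1)"
    by (simp only: of_nat_add of_nat_mult e k'_def of_nat_1 of_nat_numeral)
  have q4: "q < 4 * k"
  proof (rule ccontr)
    assume "\<not> q < 4 * k"
    define Q where "Q = int q"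
    have i: "Q \<ge> 4 * k'" "k' \<ge> 2" "N \<ge> 11 * k'"
      using \<open>\<not> q < 4 * k\<close> k n(2) by (auto simp: N_def Q_def k'_def)
    have b1: "int (2 * card E) \<le> 2 * ((N - Q) * (N - 1)) + Q * N"
      using bound1[folded of_nat_le_iff[where 'a = int]] qn nk
      by (simp add: N_def Q_def of_nat_diff)
    have "2 * ((N - k') * (N - k' - 1) + 2 * k' * (k' + 1)) < 2 * ((N - Q) * (N - 1)) + Q * N"
      using b1 b2 by simp
    \<comment> \<open>Both sides expanded. With Q >= 4k' the left side is at least 4k'N + 6k'^2 -
      2k', which exceeds 4k'N.\<close>
    then have "6 * (k' * k') + 6 * k' + Q * (N - 2) < 4 * k' * N"
      by (simp add: algebra_simps)
    moreover have "4 * k' * (N - 2) \<le> Q * (N - 2)"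
      using i by (intro mult_right_mono) auto
    moreover have "2 * k' \<le> k' * k'" using i by (intro mult_right_mono) auto
    ultimately show False using i by (simp add: algebra_simps)
  qed
  have degK: "n - q - 1 \<le> d E y" if "y \<in> K" for y
  proof -
    have "K - {y} \<subseteq> E `` {y}" using clique that by auto
    then have "card (K - {y}) \<le> d E y" unfolding d_def using finN by (intro card_mono)
    then show ?thesis using that cK finK by simp
  qed
  \<comment> \<open>A vertex of degree q + 2 has degree sum at least n + 1 with each vertex of K, so
    it is adjacent to all of K. Its degree is then at least n - q, above n/2 since q < 4k, and it
    would belong to K.\<close>
  have degF: "d E x \<le> q + 1" if x: "x \<in> F" for x
  proof (rule ccontr)
    assume "\<not> ?thesis"
    then have big: "d E x \<ge> q + 2" by simp
    have "K \<subseteq> E `` {x}"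
    proof
      fix y assume y: "y \<in> K"
      have "(x, y) \<in> E"
      proof (rule closed)
        show "n + 1 \<le> d E x + d E y" using big degK[OF y] qn by linarith
      qed (use x y KV in \<open>auto simp: F_def\<close>)
      then show "y \<in> E `` {x}" by simp
    qed
    then have "card K \<le> d E x" unfolding d_def using finN by (intro card_mono)
    then have "n + 1 \<le> 2 * d E x" using cK q4 n(2) by linarith
    then show False using x FV by (auto simp: F_def K_def)
  qed
  define A where "A = (SIGMA x:F. E `` {x})"
  have finA: "finite A" unfolding A_def using finF finN by auto
  have "card A = (\<Sum>x\<in>F. d E x)"
    unfolding A_def d_def using finF finN by simp
  also have "\<dots> \<le> (\<Sum>x\<in>F. q + 1)" using degF by (rule sum_mono)
  finally have cA: "card A \<le> q * (q + 1)" by (simp add: q_def)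
  define B where "B = (SIGMA x:K. K - {x})"
  have cB: "card B = (n - q) * (n - q - 1)"
    unfolding B_def using finK cK by simp
  have finB: "finite B" unfolding B_def using finK by auto
  \<comment> \<open>Every arc stays inside K, leaves F, or enters F.\<close>
  have "E \<subseteq> B \<union> (A \<union> A\<inverse>)"
  proof (rule subrelI)
    fix x y assume xy: "(x, y) \<in> E"
    then have "x \<in> V" "y \<in> V" "x \<noteq> y" "(y, x) \<in> E"
      using EV irr symD[OF sE] by auto
    then show "(x, y) \<in> B \<union> (A \<union> A\<inverse>)"
      using xy VKF(1) by (auto simp: A_def B_def)
  qed
  then have "card E \<le> card (B \<union> (A \<union> A\<inverse>))"
    using finA finB by (intro card_mono) auto
  also have "\<dots> \<le> card B + (card A + card (A\<inverse>))"
    by (meson add_left_mono card_Un_le le_trans)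
  also have "card (A\<inverse>) = card A" by simp
  finally have bound2: "card E \<le> (n - q) * (n - q - 1) + 2 * (q * (q + 1))"
    using cA cB by linarith
  have qk: "q < k"
  proof (rule ccontr)
    assume "\<not> q < k"
    define Q where "Q = int q"
    have i: "Q \<ge> k'" "Q + 1 \<le> 4 * k'" "k' \<ge> 2" "N \<ge> 11 * k'"
      using \<open>\<not> q < k\<close> k q4 n(2) by (auto simp: N_def Q_def k'_def)
    have q1: "q + 1 \<le> n" using q4 n(2) by linarith
    have e': "int (n - q) = N - Q" "int (n - q - 1) = N - Q - 1"
      using q1 by (auto simp: N_def Q_def)
    have "int (card E) \<le> int ((n - q) * (n - q - 1) + 2 * (q * (q + 1)))"
      using bound2 by (simp only: of_nat_le_iff)
    then have b1: "int (card E) \<le> (N - Q) * (N - Q - 1) + 2 * (Q * (Q + 1))"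
      by (simp only: of_nat_add of_nat_mult e' Q_def of_nat_1 of_nat_numeral)
    \<comment> \<open>With g(q) = (n - q)(n - q - 1) + 2q(q + 1), the product is g(k) - g(q), and
      g(k) is the density threshold. So for k <= q < 4k the bound \<open>bound2\<close> does not
      exceed the threshold.\<close>
    have "0 \<le> (Q - k') * (2 * N - 3 * (Q + k') - 3)"
      using i by (intro mult_nonneg_nonneg) auto
    then show False using b1 b2 by (simp add: algebra_simps)
  qed
  have "F \<noteq> {}" using incomplete clique VKF(1) by auto
  then obtain f where f: "f \<in> F" by blast
  \<comment> \<open>Outside degrees lie between k and q + 1, and q + 1 <= k.\<close>
  have q: "q = k - 1"
    using mind[of f] degF[OF f] f FV qk by fastforce
  have dF: "d E x = k" if "x \<in> F" for x
    using mind[of x] degF[OF that] that FV q k by fastforce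
  define W where "W = {w \<in> K. \<exists>x \<in> F. (w, x) \<in> E}"
  define Z where "Z = K - W"
  \<comment> \<open>One neighbour in F raises the degree of w to at least n - q = n - k + 1.
    Together with degree k in F this is n + 1, so w is adjacent to all of F.\<close>
  have WF: "(w, x) \<in> E" if w: "w \<in> W" and x: "x \<in> F" for w x
  proof -
    obtain y where y: "y \<in> F" "(w, y) \<in> E" and wK: "w \<in> K" using w by (auto simp: W_def)
    have "insert y (K - {w}) \<subseteq> E `` {w}" using y clique wK by auto
    then have "card (insert y (K - {w})) \<le> d E w"
      unfolding d_def using finN by (intro card_mono)
    moreover have "y \<notin> K" using y by (simp add: F_def)
    ultimately have "n - q - 1 + 1 \<le> d E w" using finK cK wK by simp
    then have "n + 1 \<le> d E w + d E x" using dF[OF x] q k n(2) by linarith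
    then show ?thesis using wK x KV FV VKF(2) by (intro closed) auto
  qed
  show ?thesis
  proof (rule that[of W Z F])
    show "V = W \<union> Z \<union> F" "W \<inter> Z = {}" "W \<inter> F = {}" "Z \<inter> F = {}"
      using VKF by (auto simp: W_def Z_def)
    show "card F = k - 1" using q by (simp add: q_def)
    show "d E x = k" if "x \<in> F" for x using dF that .
    show "(w, x) \<in> E" if "w \<in> W" "x \<in> V" "x \<noteq> w" for w x
      using WF[of w x] that clique[of w x] VKF(1) by (auto simp: W_def)
    show "(x, y) \<in> E" if "x \<in> Z" "y \<in> Z" "x \<noteq> y" for x y
      using clique that by (auto simp: Z_def)
    show "(x, y) \<notin> E" if "x \<in> Z" "y \<in> F" for x y
      using that by (auto simp: Z_def W_def)
    have finW: "finite W" using finK by (simp add: W_def)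
    have "W \<subseteq> E `` {f}" using WF f symD[OF sE] by blast
    then have "card W \<le> d E f" unfolding d_def using finN by (intro card_mono)
    then show "card W \<le> k" using dF f by simp
    \<comment> \<open>Of the k neighbours of f at most k - 2 lie in F, so at least two lie in
      W.\<close>
    have "E `` {f} \<subseteq> W \<union> (F - {f})"
    proof
      fix y assume "y \<in> E `` {f}"
      then have "(y, f) \<in> E" "y \<in> V" "y \<noteq> f" using symD[OF sE] nbV[of f] by auto
      then show "y \<in> W \<union> (F - {f})" using f VKF(1) by (auto simp: W_def)
    qed
    then have "d E f \<le> card (W \<union> (F - {f}))"
      unfolding d_def using finW finF by (intro card_mono) auto
    also have "\<dots> \<le> card W + card (F - {f})" by (rule card_Un_le)
    also have "card (F - {f}) = k - 2" using f finF q q_def by simp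
    finally show "2 \<le> card W" using dF[OF f] k by linarith
  qed
qed

text \<open>The sets come from the closure \<open>M\<close> of \<open>E\<close>. The conclusion only
  confines the neighbours of F, a property that passes from \<open>M\<close> down to
  \<open>E\<close>.\<close>

lemma dense_ham_path_or_structure:
  assumes fin: "finite V" and n: "card V = n" "n \<ge> 11 * k" and k: "k \<ge> 2"
    and E: "simple_on V E"
    and mind: "\<And>x. x \<in> V \<Longrightarrow> k \<le> card (E `` {x})"
    and dense: "card E > (n - k) * (n - k - 1) + 2 * k * (k + 1)"
    and uv: "u \<in> V" "v \<in> V" "u \<noteq> v" and no: "\<not> ham_path V E u v"
  obtains W F where "W \<subseteq> V" "F \<subseteq> V" "W \<inter> F = {}" "card F = k - 1"
    "card W = 2 \<and> E `` F \<subseteq> W \<union> F \<or> card W = k \<and> E `` F \<subseteq> W"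
proof (rule ccontr)
  assume none: "\<not> thesis"
  have "ham_path V E u v"
  proof (rule ham_path_by_closure[OF fin E uv])
    fix M assume sub: "E \<subseteq> M" and M: "simple_on V M"
      and closed: "\<And>x y. x \<in> V \<Longrightarrow> y \<in> V \<Longrightarrow> x \<noteq> y \<Longrightarrow>
        card V + 1 \<le> card (M `` {x}) + card (M `` {y}) \<Longrightarrow> (x, y) \<in> M"
      and incomplete: "\<not> (\<forall>x\<in>V. \<forall>y\<in>V. x \<noteq> y \<longrightarrow> (x, y) \<in> M)"
    have MV: "M \<subseteq> V \<times> V" and sM: "sym M" using M by (auto simp: simple_on_def)
    have finM: "finite M" using MV fin by (meson finite_SigmaI finite_subset)
    have mindM: "k \<le> card (M `` {x})" if "x \<in> V" for x
      using mind[OF that] sub finM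
      by (meson Image_mono card_mono finite_Image le_trans subset_refl)
    have denseM: "card M > (n - k) * (n - k - 1) + 2 * k * (k + 1)"
      using dense card_mono[OF finM sub] by linarith
    obtain W Z F where V: "V = W \<union> Z \<union> F"
      and disj: "W \<inter> Z = {}" "W \<inter> F = {}" "Z \<inter> F = {}"
      and cards: "card F = k - 1" "2 \<le> card W" "card W \<le> k"
      and W: "\<And>w x. w \<in> W \<Longrightarrow> x \<in> V \<Longrightarrow> x \<noteq> w \<Longrightarrow> (w, x) \<in> M"
      and Z: "\<And>x y. x \<in> Z \<Longrightarrow> y \<in> Z \<Longrightarrow> x \<noteq> y \<Longrightarrow> (x, y) \<in> M"
      and ZF: "\<And>x y. x \<in> Z \<Longrightarrow> y \<in> F \<Longrightarrow> (x, y) \<notin> M"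
      and F: "\<And>x. x \<in> F \<Longrightarrow> card (M `` {x}) = k"
    proof (rule closed_dense_structure[OF fin n k M _ denseM _ incomplete])
      show "k \<le> card (M `` {x})" if "x \<in> V" for x using mindM that .
      show "(x, y) \<in> M" if "x \<in> V" "y \<in> V" "x \<noteq> y"
        "n + 1 \<le> card (M `` {x}) + card (M `` {y})" for x y
        using closed that n(1) by simp
    qed (rule that; assumption)
    have finp: "finite W" "finite Z" "finite F" using fin V by auto
    have nbF: "y \<in> W \<union> F" if "x \<in> F" "(x, y) \<in> M" for x y
      using that ZF[of y x] symD[OF sM that(2)] MV V by auto
    have "card W \<noteq> 2"
    proof
      assume "card W = 2"
      then show False
        using none that[of W F] V disj cards nbF sub by blast
    qed
    moreover have "card W \<noteq> k"
    proof
      assume cW: "card W = k"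
      \<comment> \<open>W lies in the neighbourhood of x and already has k elements, the degree of
        x.\<close>
      have "M `` {x} = W" if x: "x \<in> F" for x
      proof -
        have "W \<subseteq> M `` {x}" using W[of _ x] x V disj symD[OF sM] by blast
        then show ?thesis
          using cW F[OF x] finM card_subset_eq[of "M `` {x}" W] by auto
      qed
      then have "E `` F \<subseteq> W" using sub by blast
      then show False using none that[of W F] V disj cards cW by blast
    qed
    moreover have "card Z \<ge> 3"
    proof -
      have "card V \<le> card W + card Z + card F"
        unfolding V by (meson add_right_mono card_Un_le le_trans)
      then show ?thesis using n k cards by linarith
    qed
    ultimately have c: "3 \<le> card W" "card W < k" "3 \<le> card Z" using cards by linarith+
    show "ham_path V M u v"
      unfolding V
      by (rule ham_path_join_clique_regular[OF finp disj M[unfolded V] W[unfolded V] Z ZF F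
            cards(1) c uv[unfolded V]])
  qed
  then show False using no by simp
qed

section \<open>Embedding into S and T\<close>

lemma iso_to_subgraphI:
  assumes G: "pair_graph G" and H: "pair_graph H"
    and f: "inj_on f (pverts G)" "f ` pverts G \<subseteq> pverts H"
    and arcs: "\<And>x y. (x, y) \<in> parcs G \<Longrightarrow> (f x, f y) \<in> parcs H"
  shows "iso_to_subgraph G H"
proof -
  note GD = pair_graphD[OF G]
  define H' where "H' = \<lparr>pverts = f ` pverts G, parcs = map_prod f f ` parcs G\<rparr>"
  have sub: "parcs H' \<subseteq> parcs H" using arcs by (auto simp: H'_def)
  have pg: "pair_graph H'"
  proof (rule pair_graphI)
    show "finite (pverts H')" using GD by (simp add: H'_def)
    show "parcs H' \<subseteq> pverts H' \<times> pverts H'" using GD(2) by (auto simp: H'_def)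
    show "sym (parcs H')" using symD[OF GD(3)] by (intro symI) (auto simp: H'_def)
    show "irrefl (parcs H')"
      using sub pair_graphD(4)[OF H] by (auto simp: irrefl_def)
  qed
  have wf: "wf_digraph (with_proj K)" if "pair_graph K" for K :: "'c pair_pre_digraph"
    using pair_graphD(2)[OF that] by (intro wf_digraph.intro) auto
  have "subgraph (with_proj H') (with_proj H)"
    using sub f(2) wf[OF pg] wf[OF H] by (simp add: subgraph_def compatibleI_with_proj) (simp add: H'_def)
  moreover have "digraph_iso (with_proj G) (with_proj H')"
  proof -
    define h where "h = \<lparr>iso_verts = f, iso_arcs = map_prod f f, iso_head = snd, iso_tail = fst\<rparr>"
    have "inj_on (map_prod f f) (parcs G)"
      using map_prod_inj_on[OF f(1) f(1)] GD(2) by (rule inj_on_subset)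
    then have "pre_digraph.digraph_isomorphism (with_proj G) h"
      using wf[OF G] f(1) by (simp add: pre_digraph.digraph_isomorphism_def h_def)
    moreover have "with_proj H' = app_iso h (with_proj G)"
      by (simp add: app_iso_def h_def H'_def)
    ultimately show ?thesis by (auto simp: digraph_iso_def)
  qed
  ultimately show ?thesis using pg by (auto simp: iso_to_subgraph_def)
qed

lemma parcs_graph_join:
  "(Inl a, Inl b) \<in> parcs (graph_join G H) \<longleftrightarrow> (a, b) \<in> parcs G"
  "(Inr c, Inr d) \<in> parcs (graph_join G H) \<longleftrightarrow> (c, d) \<in> parcs H"
  "(Inl a, Inr d) \<in> parcs (graph_join G H) \<longleftrightarrow> a \<in> pverts G \<and> d \<in> pverts H"
  "(Inr c, Inl b) \<in> parcs (graph_join G H) \<longleftrightarrow> c \<in> pverts H \<and> b \<in> pverts G"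
  by (auto simp: graph_join_def disjoint_union_def)

lemma parcs_disjoint_union:
  "(Inl a, Inl b) \<in> parcs (disjoint_union G H) \<longleftrightarrow> (a, b) \<in> parcs G"
  "(Inr c, Inr d) \<in> parcs (disjoint_union G H) \<longleftrightarrow> (c, d) \<in> parcs H"
  by (auto simp: disjoint_union_def)

lemma pverts_disjoint_union:
  "Inl a \<in> pverts (disjoint_union G H) \<longleftrightarrow> a \<in> pverts G"
  "Inr c \<in> pverts (disjoint_union G H) \<longleftrightarrow> c \<in> pverts H"
  by (auto simp: disjoint_union_def)

text \<open>S and T share this shape, differing in |W| and in H. The target has all edges within the
  images of W and of Z and all edges at W, so only arcs between Z and F and inside F need checking.
  The condition inside F ranges over all bijections \<open>h\<close> because the numbering of F is
  chosen in the proof.\<close>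

lemma iso_to_subgraph_joinI:
  assumes G: "pair_graph G" and H: "pair_graph H" "pverts H = {..<card F}"
    and V: "pverts G = W \<union> Z \<union> F" and disj: "W \<inter> Z = {}" "W \<inter> F = {}" "Z \<inter> F = {}"
    and ZF: "\<And>x y. (x, y) \<in> parcs G \<Longrightarrow> x \<in> F \<Longrightarrow> y \<notin> Z"
    and F: "\<And>h x y. bij_betw h F {..<card F} \<Longrightarrow> (x, y) \<in> parcs G \<Longrightarrow> x \<in> F \<Longrightarrow> y \<in> F \<Longrightarrow>
      (h x, h y) \<in> parcs H"
  shows "iso_to_subgraph G
    (graph_join (complete_graph (card W)) (disjoint_union (complete_graph (card Z)) H))"
proof -
  note GD = pair_graphD[OF G]
  have "finite W" "finite Z" "finite F" using GD(1) V by auto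
  then obtain g1 g2 h where g1: "bij_betw g1 W {..<card W}" and g2: "bij_betw g2 Z {..<card Z}"
    and h: "bij_betw h F {..<card F}"
    using ex_bij_betw_finite_nat by (metis lessThan_atLeast0)
  define f where "f x = (if x \<in> W then Inl (g1 x)
    else if x \<in> Z then Inr (Inl (g2 x)) else Inr (Inr (h x)))" for x
  have mem: "g1 x < card W" if "x \<in> W" for x using g1 that by (auto simp: bij_betw_def)
  have mem2: "g2 x < card Z" if "x \<in> Z" for x using g2 that by (auto simp: bij_betw_def)
  have mem3: "h x < card F" if "x \<in> F" for x using h that by (auto simp: bij_betw_def)
  have inj: "inj_on g1 W" "inj_on g2 Z" "inj_on h F"
    using g1 g2 h by (auto simp: bij_betw_def)
  show ?thesis
  proof (rule iso_to_subgraphI[where f = f])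
    show "inj_on f (pverts G)"
      using inj unfolding V by (auto simp: inj_on_def f_def)
    show "f ` pverts G \<subseteq> pverts (graph_join (complete_graph (card W))
        (disjoint_union (complete_graph (card Z)) H))"
      using mem mem2 mem3 unfolding V
      by (auto simp: f_def graph_join_def disjoint_union_def complete_graph_def H(2))
    fix x y assume xy: "(x, y) \<in> parcs G"
    then have yx: "(y, x) \<in> parcs G" and ne: "x \<noteq> y" and mems: "x \<in> W \<union> Z \<union> F" "y \<in> W \<union> Z \<union> F"
      using symD[OF GD(3)] GD(2,4) V by (auto simp: irrefl_def)
    let ?join = "graph_join (complete_graph (card W)) (disjoint_union (complete_graph (card Z)) H)"
    have fW: "f x = Inl (g1 x)" if "x \<in> W" for x using that by (simp add: f_def)
    have fZ: "f x = Inr (Inl (g2 x))" if "x \<in> Z" for x using that disj by (auto simp: f_def)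
    have fF: "f x = Inr (Inr (h x))" if "x \<in> F" for x using that disj by (auto simp: f_def)
    have "g1 x \<noteq> g1 y" if "x \<in> W" "y \<in> W" using that ne inj(1) by (auto dest: inj_onD)
    moreover have "g2 x \<noteq> g2 y" if "x \<in> Z" "y \<in> Z" using that ne inj(2) by (auto dest: inj_onD)
    ultimately show "(f x, f y) \<in> parcs ?join"
      using mems ZF[OF xy] ZF[OF yx] F[OF h xy] mem mem2 mem3
      by (elim UnE)
        (simp_all add: fW fZ fF parcs_graph_join parcs_disjoint_union pverts_disjoint_union
          complete_graph_def H(2))
  qed (intro G pair_graph_join pair_graph_disjoint_union pair_graph_complete H)+
qed

section \<open>Transfer between graph records and relations\<close>

text \<open>The arcs split into disjoint classes by underlying edge, and each class contains both
  orientations, which differ as there are no loops.\<close>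

lemma two_num_edges_le_card_parcs:
  assumes "pair_graph G"
  shows "2 * num_edges G \<le> card (parcs G)"
proof -
  note GD = pair_graphD[OF assms]
  have fin: "finite (parcs G)" using GD(1,2) by (meson finite_SigmaI finite_subset)
  have edges: "edges G = (\<lambda>(u, v). {u, v}) ` parcs G" by (auto simp: edges_def)
  define A where "A e = {a \<in> parcs G. {fst a, snd a} = e}" for e
  have "2 \<le> card (A e)" if e: "e \<in> edges G" for e
  proof -
    obtain u v where uv: "(u, v) \<in> parcs G" "e = {u, v}"
      using e unfolding edges_def by blast
    then have "{(u, v), (v, u)} \<subseteq> A e" "u \<noteq> v"
      using symD[OF GD(3)] GD(4) by (auto simp: A_def irrefl_def)
    moreover have "finite (A e)" using fin by (simp add: A_def)
    ultimately have "card {(u, v), (v, u)} \<le> card (A e)" by (intro card_mono)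
    then show ?thesis using \<open>u \<noteq> v\<close> by simp
  qed
  then have "card (edges G) * 2 \<le> (\<Sum>e\<in>edges G. card (A e))"
    using sum_bounded_below[of "edges G" 2 "\<lambda>e. card (A e)"] by simp
  also have "\<dots> = card (\<Union>e\<in>edges G. A e)"
  proof (rule card_UN_disjoint[symmetric])
    show "finite (edges G)" using fin by (simp add: edges)
    show "\<forall>e\<in>edges G. finite (A e)" using fin by (simp add: A_def)
    show "\<forall>e\<in>edges G. \<forall>e'\<in>edges G. e \<noteq> e' \<longrightarrow> A e \<inter> A e' = {}" unfolding A_def by blast
  qed
  also have "\<dots> \<le> card (parcs G)"
  proof (rule card_mono[OF fin])
    show "(\<Union>e\<in>edges G. A e) \<subseteq> parcs G" unfolding A_def by blast
  qed
  finally show ?thesis by (simp add: num_edges_def)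
qed

lemma min_degree_le_card_nbrs:
  assumes "finite (pverts G)" "x \<in> pverts G"
  shows "min_degree G \<le> card (parcs G `` {x})"
proof -
  have "out_arcs (with_proj G) x = Pair x ` (parcs G `` {x})"
    by (auto simp: out_arcs_def)
  then have "out_degree (with_proj G) x = card (parcs G `` {x})"
    by (simp add: out_degree_def card_image inj_on_def)
  then show ?thesis
    using assms unfolding min_degree_def by (metis Min_le finite_imageI imageI)
qed

lemma ham_path_imp_hamilton_path:
  assumes "ham_path (pverts G) (parcs G) u v"
  obtains p where "hamilton_path G u p v"
proof -
  obtain p where p: "p \<noteq> []" "distinct p" "set p = pverts G" "hd p = u" "last p = v"
    and s: "successively (\<lambda>a b. (a, b) \<in> parcs G) p"
    using assms unfolding ham_path.simps by blast
  have "set (vwalk_arcs p) \<subseteq> parcs G"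
    using s by (induction p rule: vwalk_arcs.induct) auto
  then have "vwalk p (with_proj G)"
    using p by (intro vwalkI) auto
  then have "hamilton_path G u p v"
    using p by (auto simp: hamilton_path_def)
  then show ?thesis by (rule that)
qed

theorem theorem3p1:
  fixes G :: "'a pair_pre_digraph" and n k :: nat
  assumes "k \<ge> 2"
    and "pair_graph G"
    and "card (pverts G) = n"
    and "n \<ge> 11 * k"
    and "min_degree G \<ge> k"
    and "num_edges G > ((n - k) choose 2) + k * (k + 1)"
    and "\<not> (iso_to_subgraph G (S_graph n k) \<or> iso_to_subgraph G (T_graph n k))"
  shows "hamilton_connected G"
  unfolding hamilton_connected_def
proof (intro ballI impI)
  note GD = pair_graphD[OF assms(2)]
  fix u v assume uv: "u \<in> pverts G" "v \<in> pverts G" "u \<noteq> v"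
  have simple: "simple_on (pverts G) (parcs G)"
    using GD by (simp add: simple_on_def)
  have mind: "k \<le> card (parcs G `` {x})" if "x \<in> pverts G" for x
    using min_degree_le_card_nbrs[OF GD(1) that] assms(5) by linarith
  \<comment> \<open>Evenness undoes the truncating division in \<open>choose_two\<close>.\<close>
  have "even (m * (m - 1))" for m :: nat by (cases "even m") auto
  then have "2 * (m choose 2) = m * (m - 1)" for m :: nat
    by (simp only: choose_two dvd_mult_div_cancel)
  from this[of "n - k"] have dense: "card (parcs G) > (n - k) * (n - k - 1) + 2 * k * (k + 1)"
    using two_num_edges_le_card_parcs[OF assms(2)] assms(6) by (simp only: mult.assoc)
  have "ham_path (pverts G) (parcs G) u v"
  proof (rule ccontr)
    assume "\<not> ?thesis"
    then obtain W F where WF: "W \<subseteq> pverts G" "F \<subseteq> pverts G" "W \<inter> F = {}" "card F = k - 1"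
      and alt: "card W = 2 \<and> parcs G `` F \<subseteq> W \<union> F \<or> card W = k \<and> parcs G `` F \<subseteq> W"
      using dense_ham_path_or_structure[OF GD(1) assms(3,4,1) simple mind dense uv] by metis
    define Z where "Z = pverts G - W - F"
    have V: "pverts G = W \<union> Z \<union> F" and disj: "W \<inter> Z = {}" "Z \<inter> F = {}"
      using WF by (auto simp: Z_def)
    have ZF: "y \<notin> Z" if "(x, y) \<in> parcs G" "x \<in> F" for x y
      using alt that by (auto simp: Z_def)
    have "card Z = card (pverts G - W) - card F"
      unfolding Z_def using WF GD(1) by (intro card_Diff_subset) (auto intro: finite_subset)
    also have "card (pverts G - W) = n - card W"
      unfolding assms(3)[symmetric] using WF GD(1)
      by (intro card_Diff_subset) (auto intro: finite_subset)
    finally have "card Z = n - card W - card F" .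
    from alt show False
    proof (elim disjE conjE)
      assume "card W = 2" "parcs G `` F \<subseteq> W \<union> F"
      have "iso_to_subgraph G (graph_join (complete_graph (card W))
          (disjoint_union (complete_graph (card Z)) (complete_graph (k - 1))))"
      proof (rule iso_to_subgraph_joinI[OF assms(2) pair_graph_complete _ V disj(1) WF(3) disj(2) ZF])
        fix h x y assume h: "bij_betw h F {..<card F}" and xy: "(x, y) \<in> parcs G" "x \<in> F" "y \<in> F"
        then have "x \<noteq> y" using GD(4) by (auto simp: irrefl_def)
        then have "h x \<noteq> h y" using h xy by (auto simp: bij_betw_def dest: inj_onD)
        then show "(h x, h y) \<in> parcs (complete_graph (k - 1))"
          using h xy WF(4) by (auto simp: complete_graph_def bij_betw_def)
      qed (use WF(4) in \<open>auto simp: complete_graph_def\<close>)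
      moreover have "card Z = n - (k + 1)"
        using \<open>card Z = n - card W - card F\<close> \<open>card W = 2\<close> WF(4) assms(1) by simp
      ultimately have "iso_to_subgraph G (T_graph n k)"
        using \<open>card W = 2\<close> by (simp add: T_graph_def)
      then show False using assms(7) by blast
    next
      assume "card W = k" "parcs G `` F \<subseteq> W"
      have "iso_to_subgraph G (graph_join (complete_graph (card W))
          (disjoint_union (complete_graph (card Z)) (edgeless_graph (k - 1))))"
      proof (rule iso_to_subgraph_joinI[OF assms(2) pair_graph_edgeless _ V disj(1) WF(3) disj(2) ZF])
        fix h :: "'a \<Rightarrow> nat" and x y assume "(x, y) \<in> parcs G" "x \<in> F" "y \<in> F"
        \<comment> \<open>F is independent here: its neighbours all lie in W.\<close>
        then have False using \<open>parcs G `` F \<subseteq> W\<close> WF(3) by blast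
        then show "(h x, h y) \<in> parcs (edgeless_graph (k - 1))" ..
      qed (use WF(4) in \<open>auto simp: edgeless_graph_def\<close>)
      moreover have "card Z = n - (2 * k - 1)"
        using \<open>card Z = n - card W - card F\<close> \<open>card W = k\<close> WF(4) assms(1) by simp
      ultimately have "iso_to_subgraph G (S_graph n k)"
        using \<open>card W = k\<close> by (simp add: S_graph_def)
      then show False using assms(7) by blast
    qed
  qed
  then show "\<exists>p. hamilton_path G u p v"
    by (rule ham_path_imp_hamilton_path) blast
qed

end
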